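(* Let $A,B\in\mathbb{C}^{n\times n}$ be such that for each $i\in\{1,\dots,n\}$ the $i$th row of at least one of $A$ and $B$ is strictly diagonally dominant. With $\Gamma_i^S(A,B)$ as defined in the context, all the eigenvalues (finite or infinite) of the pencil $A-\lambda B$ lie in $\Gamma^S(A,B)=\bigcup_{1\le i\le n}\Gamma_i^S(A,B)$.
   Context: Write $A=(a_{i,j})$, $B=(b_{i,j})$. The $i$th row of a matrix $M=(m_{i,j})$ is strictly diagonally dominant if $|m_{i,i}|>\sum_{j\ne i}|m_{i,j}|$. Eigenvalues: $\lambda\in\mathbb{C}$ is a finite eigenvalue of the pencil $A-\lambda B$ if $\det(A-\lambda B)=0$ (equivalently $A\bm{x}=\lambda B\bm{x}$ for some $\bm{x}\neq 0$). If the polynomial $\det(A-\lambda B)$ has degree $d<n$, the pencil has $n-d$ infinite eigenvalues; $\infty$ is an eigenvalue exactly when $B\bm{x}=0$ for some $\bm{x}\ne0$. All regions are subsets of the extended plane $\mathbb{C}\cup\{\infty\}$. Let $S^B$ (resp. $S^A$) be the set of $i$ such that the $i$th row of $B$ (resp. $A$) is strictly diagonally dominant. Definition of $\Gamma_i^B(A,B)$. For $i\in S^B$ let $r_i=\sum_{j\ne i}|b_{i,j}|/|b_{i,i}|\;(<1)$, $R_i=\sum_{j\neq i}|a_{i,j}|$, $\rho_i=\frac{|a_{i,i}|r_i+R_i}{|b_{i,i}|(1-r_i)}$, and $\Gamma_i^B(A,B)=\{z\in\mathbb{C}:|z-a_{i,i}/b_{i,i}|\le\rho_i\}$. Definition of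 $\Gamma_i^A(A,B)$. For $i\in S^A$ let $r_i^A=\sum_{j\ne i}|a_{i,j}|/|a_{i,i}|\;(<1)$ and $R_i^A=\sum_{j\ne i}|b_{i,j}|$. If $b_{i,i}=R_i^A=0$, then $\Gamma_i^A(A,B)=\{\infty\}$. If $b_{i,i}=0$ and $R_i^A>0$, then $\Gamma_i^A(A,B)=\{z\in\mathbb{C}:|z|\ge\frac{|a_{i,i}|}{R_i^A}(1-r_i^A)\}\cup\{\infty\}$. If $b_{i,i}\ne0$, let $\alpha_i=\frac{a_{i,i}}{b_{i,i}}$, $\beta_i=\frac{|b_{i,i}|r_i^A+R_i^A}{|b_{i,i}|(1-r_i^A)}$ and, when $\beta_i\neq1$, $c_i=\frac{\alpha_i}{1-\beta_i^2}$, $\rho_i^A=\frac{|\alpha_i|\beta_i}{|1-\beta_i^2|}$; then: if $\beta_i<1$, $\Gamma_i^A(A,B)=\{z\in\mathbb{C}:|z-c_i|\le\rho_i^A\}$; if $\beta_i>1$, $\Gamma_i^A(A,B)=\{z\in\mathbb{C}:|z-c_i|\ge\rho_i^A\}\cup\{\infty\}$; if $\beta_i=1$, $\Gamma_i^A(A,B)=\{z\in\mathbb{C}:|z-\alpha_i|\le|z|\}\cup\{\infty\}$. For $i\notin S^A$, $\Gamma_i^A(A,B)$ is the whole plane, including the point $\infty$. Definition of $\Gamma_i^S(A,B)$. $\Gamma_i^S(A,B)=\Gamma_i^B(A,B)$ if $i\in S^B$, and $\Gamma_i^S(A,B)=\Gamma_i^A(A,B)$ if $i\notin S^B$. *)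

theory Defs
  imports "HOL-Analysis.Analysis" "HOL-Computational_Algebra.Polynomial"
begin

datatype ext_complex = Fin complex | Infty

definition strictly_diag_dominant_row :: "complex^'n^'n \<Rightarrow> 'n::finite \<Rightarrow> bool" where
  "strictly_diag_dominant_row M i \<longleftrightarrow>
     (\<Sum>j\<in>UNIV - {i}. cmod (M $ i $ j)) < cmod (M $ i $ i)"

definition pencil :: "complex^'n^'n \<Rightarrow> complex^'n^'n \<Rightarrow> complex \<Rightarrow> complex^'n^'n" where
  "pencil A B z = (\<chi> i j. A $ i $ j - z * B $ i $ j)"

definition pencil_poly :: "complex^'n^'n \<Rightarrow> complex^'n^'n::finite \<Rightarrow> complex poly" where
  "pencil_poly A B = det (\<chi> i j. [:A $ i $ j, - B $ i $ j:])"

text \<open>The pencil is not assumed regular. If \<open>pencil_poly A B\<close> vanishes identically, every point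
  of the extended plane is an eigenvalue: \<open>degree 0 = 0\<close>, which is less than the dimension.\<close>

definition pencil_eigenvalues :: "complex^'n^'n \<Rightarrow> complex^'n^'n::finite \<Rightarrow> ext_complex set" where
  "pencil_eigenvalues A B =
     {Fin z | z. det (pencil A B z) = 0} \<union>
     (if degree (pencil_poly A B) < CARD('n) then {Infty} else {})"

text \<open>\<open>Gamma_B A B i\<close> is meaningful only if row \<open>i\<close> of \<open>B\<close> is strictly diagonally dominant
  (so that \<open>r < 1\<close> and \<open>B $ i $ i \<noteq> 0\<close>); \<open>Gamma_S\<close> uses it only in that case.\<close>

definition Gamma_B :: "complex^'n^'n \<Rightarrow> complex^'n^'n \<Rightarrow> 'n::finite \<Rightarrow> ext_complex set" where
  "Gamma_B A B i =
     (let a = A $ i $ i; b = B $ i $ i;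
          r = (\<Sum>j\<in>UNIV - {i}. cmod (B $ i $ j)) / cmod b;
          R = (\<Sum>j\<in>UNIV - {i}. cmod (A $ i $ j));
          \<rho> = (cmod a * r + R) / (cmod b * (1 - r))
      in Fin ` {z. cmod (z - a / b) \<le> \<rho>})"

definition Gamma_A :: "complex^'n^'n \<Rightarrow> complex^'n^'n \<Rightarrow> 'n::finite \<Rightarrow> ext_complex set" where
  "Gamma_A A B i =
     (if \<not> strictly_diag_dominant_row A i then UNIV
      else
        let a = A $ i $ i; b = B $ i $ i;
            r = (\<Sum>j\<in>UNIV - {i}. cmod (A $ i $ j)) / cmod a;
            R = (\<Sum>j\<in>UNIV - {i}. cmod (B $ i $ j))
        in if b = 0 then
             (if R = 0 then {Infty}
              else Fin ` {z. cmod z \<ge> cmod a / R * (1 - r)} \<union> {Infty})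
           else
             let \<alpha> = a / b;
                 \<beta> = (cmod b * r + R) / (cmod b * (1 - r));
                 c = \<alpha> / complex_of_real (1 - \<beta>\<^sup>2);
                 \<rho> = cmod \<alpha> * \<beta> / \<bar>1 - \<beta>\<^sup>2\<bar>
             in if \<beta> < 1 then Fin ` {z. cmod (z - c) \<le> \<rho>}
                else if \<beta> > 1 then Fin ` {z. cmod (z - c) \<ge> \<rho>} \<union> {Infty}
                else Fin ` {z. cmod (z - \<alpha>) \<le> cmod z} \<union> {Infty})"

definition Gamma_S :: "complex^'n^'n \<Rightarrow> complex^'n^'n \<Rightarrow> 'n::finite \<Rightarrow> ext_complex set" where
  "Gamma_S A B i = (if strictly_diag_dominant_row B i then Gamma_B A B i else Gamma_A A B i)"

lemma poly_pencil_poly: "poly (pencil_poly A B) z = det (pencil A B z)"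
  by (simp add: pencil_poly_def pencil_def det_def poly_sum poly_prod)

lemma Fin_in_pencil_eigenvalues:
  "Fin z \<in> pencil_eigenvalues A B \<longleftrightarrow> (\<exists>x. x \<noteq> 0 \<and> A *v x = z *s (B *v x))"
proof -
  have "pencil A B z *v x = A *v x - z *s (B *v x)" for x
    by (simp add: pencil_def vec_eq_iff matrix_vector_mult_def left_diff_distrib
        sum_subtractf sum_distrib_left mult.assoc)
  moreover have "det M = 0 \<longleftrightarrow> (\<exists>x. x \<noteq> 0 \<and> M *v x = 0)" for M :: "complex^'a^'a"
    by (metis invertible_det_nz invertible_left_inverse matrix_left_invertible_ker)
  ultimately show ?thesis
    by (auto simp: pencil_eigenvalues_def)
qed

lemma prod_linear_poly:
  fixes f g :: "'a \<Rightarrow> complex"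
  assumes "finite S"
  shows "degree (\<Prod>i\<in>S. [:f i, g i:]) \<le> card S \<and>
         coeff (\<Prod>i\<in>S. [:f i, g i:]) (card S) = (\<Prod>i\<in>S. g i)"
  using assms
proof (induction S)
  case empty
  then show ?case by simp
next
  case (insert x S)
  let ?P = "\<Prod>i\<in>S. [:f i, g i:]"
  have c: "coeff ?P (Suc (card S)) = 0"
    using insert.IH by (intro coeff_eq_0) simp
  have "degree ([:f x, g x:] * ?P) \<le> 1 + card S"
    using insert.IH by (intro order.trans[OF degree_mult_le] add_mono) auto
  then show ?case using insert c by simp
qed

lemma Infty_in_pencil_eigenvalues:
  fixes A B :: "complex^'n^'n"
  shows "Infty \<in> pencil_eigenvalues A B \<longleftrightarrow> (\<exists>x. x \<noteq> 0 \<and> B *v x = 0)"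
proof -
  let ?P = "\<lambda>p. \<Prod>i\<in>(UNIV::'n set). [:A $ i $ p i, - B $ i $ p i:]"
  note P = prod_linear_poly[OF finite_class.finite_UNIV]
  have eq: "pencil_poly A B = (\<Sum>p | p permutes UNIV. of_int (sign p) * ?P p)"
    by (simp add: pencil_poly_def det_def)
  have "degree (of_int (sign p) * ?P p) \<le> CARD('n)" for p :: "'n \<Rightarrow> 'n"
    using P[of "\<lambda>i. A $ i $ p i" "\<lambda>i. - B $ i $ p i"]
    by (cases rule: sign_cases[of p]) auto
  then have d: "degree (pencil_poly A B) \<le> CARD('n)"
    unfolding eq by (intro degree_sum_le) auto
  have "coeff (of_int (sign p) * ?P p) CARD('n)
      = of_int (sign p) * (\<Prod>i\<in>UNIV. - B $ i $ p i)" for p :: "'n \<Rightarrow> 'n"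
    using P[of "\<lambda>i. A $ i $ p i" "\<lambda>i. - B $ i $ p i"]
    by (cases rule: sign_cases[of p]) auto
  then have c: "coeff (pencil_poly A B) CARD('n) = (-1) ^ CARD('n) * det B"
    unfolding eq by (simp add: coeff_sum det_def prod_uminus sum_distrib_left mult_ac)
  have "degree (pencil_poly A B) < CARD('n) \<longleftrightarrow> coeff (pencil_poly A B) CARD('n) = 0"
    using d by (metis coeff_eq_0 degree_0 eq_zero_or_degree_less
        le_neq_implies_less zero_less_card_finite)
  also have "\<dots> \<longleftrightarrow> det B = 0" by (simp add: c)
  also have "\<dots> \<longleftrightarrow> (\<exists>x. x \<noteq> 0 \<and> B *v x = 0)"
    by (metis invertible_det_nz invertible_left_inverse matrix_left_invertible_ker)
  finally show ?thesis by (auto simp: pencil_eigenvalues_def)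
qed

end

theory Submission imports Defs begin

text \<open>Let \<open>x\<close> be an eigenvector and \<open>i\<close> the index of an entry of maximal modulus. Dividing row
  \<open>i\<close> of \<open>A x = z B x\<close> by \<open>x\<^sub>i\<close> gives \<open>a + t = z (b + s)\<close>, where \<open>t\<close> and \<open>s\<close> are bounded by the
  absolute off-diagonal row sums of \<open>A\<close> and \<open>B\<close>. Hence \<open>z\<close> is a perturbation of \<open>a / b\<close> if
  row \<open>i\<close> of \<open>B\<close> is dominant, and \<open>1 / z\<close> is a perturbation of \<open>b / a\<close> if row \<open>i\<close> of \<open>A\<close> is.
  The bound on \<open>1 / z\<close> reads \<open>\<bar>z - \<alpha>\<bar> \<le> \<beta> \<bar>z\<bar>\<close>: a disk, a half-plane or the exterior of a disk
  bounded by a circle of Apollonius.\<close>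

lemma exists_max_entry:
  fixes x :: "complex^'n"
  assumes "x \<noteq> 0"
  obtains i where "x $ i \<noteq> 0" and "\<And>j. cmod (x $ j) \<le> cmod (x $ i)"
proof -
  let ?m = "Max (range (\<lambda>j. cmod (x $ j)))"
  have "?m \<in> range (\<lambda>j. cmod (x $ j))"
    by (rule Max_in) auto
  then obtain i where i: "?m = cmod (x $ i)"
    by (rule rangeE)
  have le: "cmod (x $ j) \<le> cmod (x $ i)" for j
    unfolding i[symmetric] by (rule Max_ge) auto
  obtain k where "x $ k \<noteq> 0"
    using assms by (auto simp: vec_eq_iff)
  with le[of k] have "x $ i \<noteq> 0"
    by auto
  with le show thesis
    by (rule that[rotated])
qed

text \<open>The Gershgorin step: by maximality the weights \<open>x $ j / x $ i\<close> have modulus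
  at most 1, so the weighted off-diagonal sum obeys the unweighted bound. It is applied to
  \<open>A\<close> and to \<open>B\<close> with the same \<open>x\<close> and
  \<open>i\<close>.\<close>

lemma row_at_max_entry:
  fixes M :: "complex^'n^'n"
  assumes "x $ i \<noteq> 0" and "\<And>j. cmod (x $ j) \<le> cmod (x $ i)"
  obtains t where "(M *v x) $ i = x $ i * (M $ i $ i + t)"
    and "cmod t \<le> (\<Sum>j\<in>UNIV - {i}. cmod (M $ i $ j))"
proof
  let ?t = "\<Sum>j\<in>UNIV - {i}. M $ i $ j * (x $ j / x $ i)"
  have "(M *v x) $ i = M $ i $ i * x $ i + (\<Sum>j\<in>UNIV - {i}. M $ i $ j * x $ j)"
    unfolding matrix_vector_mult_def by (simp add: sum.remove[of UNIV i])
  also have "\<dots> = x $ i * (M $ i $ i + ?t)"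
    using assms(1) by (simp add: distrib_left sum_distrib_left mult_ac)
  finally show "(M *v x) $ i = x $ i * (M $ i $ i + ?t)" .
  have "cmod ?t \<le> (\<Sum>j\<in>UNIV - {i}. cmod (M $ i $ j) * (cmod (x $ j) / cmod (x $ i)))"
    by (rule sum_norm_le) (simp add: norm_mult norm_divide)
  also have "\<dots> \<le> (\<Sum>j\<in>UNIV - {i}. cmod (M $ i $ j))"
    using assms by (intro sum_mono mult_left_le) (auto simp: divide_le_eq_1)
  finally show "cmod ?t \<le> (\<Sum>j\<in>UNIV - {i}. cmod (M $ i $ j))" .
qed

text \<open>Multiplying \<open>z - a / b\<close> by \<open>b + s\<close> leaves only
  \<open>t - a * s / b\<close>, and \<open>b + s\<close> has modulus at least
  \<open>cmod b - S > 0\<close>. The scalars are kept abstract because the bound serves twice: for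
  \<open>z\<close> near \<open>a / b\<close>, and for \<open>1 / z\<close> near
  \<open>b / a\<close>.\<close>

lemma perturbed_quotient_bound:
  fixes a b s t z :: complex
  assumes "a + t = z * (b + s)" "cmod t \<le> R" "cmod s \<le> S" "S < cmod b"
  shows "cmod (z - a / b) \<le> (cmod a * (S / cmod b) + R) / (cmod b * (1 - S / cmod b))"
proof -
  have "cmod b > 0"
    using assms(3,4) norm_ge_zero[of s] by linarith
  then have b: "b \<noteq> 0"
    by simp
  have bs: "cmod b - S \<le> cmod (b + s)"
    using assms(3) norm_diff_ineq[of b s] by linarith
  with assms(4) have "b + s \<noteq> 0"
    by auto
  have "(z - a / b) * (b + s) = z * (b + s) - a - a * s / b"
    using b by (simp add: field_simps)
  also have "\<dots> = t - a * s / b"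
    by (simp flip: assms(1))
  finally have "(z - a / b) * (b + s) = t - a * s / b" .
  then have "cmod (z - a / b) * cmod (b + s) = cmod (t - a * s / b)"
    by (metis norm_mult)
  also have "\<dots> \<le> cmod t + cmod (a * s / b)"
    by (rule norm_triangle_ineq4)
  also have "\<dots> \<le> R + cmod a * (S / cmod b)"
    using assms(2,3) b
    by (auto simp: norm_mult norm_divide intro!: add_mono divide_right_mono mult_left_mono)
  finally have *: "cmod (z - a / b) * cmod (b + s) \<le> R + cmod a * (S / cmod b)" .
  have "cmod (z - a / b) * (cmod b - S) \<le> cmod (z - a / b) * cmod (b + s)"
    using bs by (intro mult_left_mono) auto
  with * have "cmod (z - a / b) * (cmod b - S) \<le> cmod a * (S / cmod b) + R"
    by linarith
  moreover have "cmod b * (1 - S / cmod b) = cmod b - S"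
    using b by (simp add: field_simps)
  ultimately show ?thesis
    using assms(4) by (simp add: pos_le_divide_eq)
qed

text \<open>Completing the square moves the centre from \<alpha> to the centre of the Apollonius
  circle. The sign of the factor \<open>1 - \<beta>\<^sup>2\<close> then decides between the inside
  and the outside of that circle.\<close>

lemma Apollonius_identity:
  fixes z \<alpha> :: complex and \<beta> :: real
  assumes "\<beta>\<^sup>2 \<noteq> 1"
  shows "(cmod (z - \<alpha>))\<^sup>2 - (\<beta> * cmod z)\<^sup>2 =
    (1 - \<beta>\<^sup>2) * ((cmod (z - \<alpha> / complex_of_real (1 - \<beta>\<^sup>2)))\<^sup>2
      - (cmod \<alpha> * \<beta> / \<bar>1 - \<beta>\<^sup>2\<bar>)\<^sup>2)"
proof -
  \<comment> \<open>Once \<open>\<beta>\<^sup>2\<close> is written as \<open>1 - k\<close>, both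
    sides are rational in \<open>k\<close> and the real and imaginary parts, with powers of
    \<open>k\<close> as the only denominators.\<close>
  define k where "k = 1 - \<beta>\<^sup>2"
  have k: "k \<noteq> 0" "\<beta>\<^sup>2 = 1 - k"
    using assms by (auto simp: k_def)
  have "\<alpha> / complex_of_real k = Complex (Re \<alpha> / k) (Im \<alpha> / k)"
    by (simp add: complex_eq_iff)
  then show ?thesis
    unfolding k_def[symmetric] using k(1)
    by (simp add: cmod_power2 power_mult_distrib power_divide k(2))
      (simp add: field_simps power2_eq_square)
qed

text \<open>Dominance of \<open>a\<close> forces \<open>z\<close> to be nonzero, so the quotient
  bound applies to \<open>1 / z\<close> and \<open>b / a\<close>. Multiplying by the modulus of
  \<open>z * a / b\<close> returns to \<open>z - a / b\<close> and produces the factor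
  \<open>cmod z\<close> on the right.\<close>

lemma Gamma_A_bound:
  fixes a b s t z :: complex
  assumes "a + t = z * (b + s)" "cmod t \<le> S" "cmod s \<le> R" "S < cmod a" "b \<noteq> 0"
  shows "cmod (z - a / b) \<le>
    (cmod b * (S / cmod a) + R) / (cmod b * (1 - S / cmod a)) * cmod z"
proof -
  have "cmod a - cmod t \<le> cmod (a + t)"
    using norm_diff_ineq[of a t] by linarith
  then have z: "z \<noteq> 0"
    using assms(1,2,4) by auto
  have "cmod a > 0"
    using assms(2,4) norm_ge_zero[of t] by linarith
  then have a: "a \<noteq> 0"
    by simp
  have "b + s = (1 / z) * (a + t)"
    using assms(1) z by simp
  from perturbed_quotient_bound[OF this assms(3,2,4)]
  have *: "cmod (1 / z - b / a) \<le> (cmod b * (S / cmod a) + R) / (cmod a * (1 - S / cmod a))" .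
  have "z - a / b = - (z * a / b) * (1 / z - b / a)"
    using z a assms(5) by (simp add: field_simps)
  then have "cmod (z - a / b) = cmod z * cmod a / cmod b * cmod (1 / z - b / a)"
    by (metis norm_mult norm_divide norm_minus_cancel)
  also have "\<dots> \<le> cmod z * cmod a / cmod b *
      ((cmod b * (S / cmod a) + R) / (cmod a * (1 - S / cmod a)))"
    using * by (intro mult_left_mono) auto
  also have "\<dots> = (cmod b * (S / cmod a) + R) / (cmod b * (1 - S / cmod a)) * cmod z"
    using a by simp
  finally show ?thesis .
qed

lemma Fin_in_Gamma_B:
  assumes "strictly_diag_dominant_row B i"
    and "A $ i $ i + t = z * (B $ i $ i + s)"
    and "cmod t \<le> (\<Sum>j\<in>UNIV - {i}. cmod (A $ i $ j))"
    and "cmod s \<le> (\<Sum>j\<in>UNIV - {i}. cmod (B $ i $ j))"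
  shows "Fin z \<in> Gamma_B A B i"
  using perturbed_quotient_bound[OF assms(2-4)] assms(1)
  by (simp add: Gamma_B_def strictly_diag_dominant_row_def Let_def)

lemma Fin_in_Gamma_A:
  assumes eq: "A $ i $ i + t = z * (B $ i $ i + s)"
    and t: "cmod t \<le> (\<Sum>j\<in>UNIV - {i}. cmod (A $ i $ j))"
    and s: "cmod s \<le> (\<Sum>j\<in>UNIV - {i}. cmod (B $ i $ j))"
  shows "Fin z \<in> Gamma_A A B i"
proof (cases "strictly_diag_dominant_row A i")
  case False
  then show ?thesis
    by (simp add: Gamma_A_def)
next
  case True
  define S where "S = (\<Sum>j\<in>UNIV - {i}. cmod (A $ i $ j))"
  define R where "R = (\<Sum>j\<in>UNIV - {i}. cmod (B $ i $ j))"
  define a where "a = A $ i $ i"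
  define b where "b = B $ i $ i"
  note eq = eq[folded a_def b_def] and t = t[folded S_def] and s = s[folded R_def]
  have Sa: "S < cmod a"
    using True by (simp add: strictly_diag_dominant_row_def S_def a_def)
  have at: "cmod a - S \<le> cmod (a + t)"
    using t norm_diff_ineq[of a t] by linarith
  have S0: "0 \<le> S" and R0: "0 \<le> R"
    by (auto simp: S_def R_def intro: sum_nonneg)
  show ?thesis
  proof (cases "b = 0")
    case b: True
    have "cmod (a + t) = cmod z * cmod s"
      using eq b by (simp add: norm_mult)
    also have "\<dots> \<le> cmod z * R"
      using s by (intro mult_left_mono) auto
    finally have le: "cmod a - S \<le> cmod z * R"
      using at by linarith
    \<comment> \<open>For \<open>R = 0\<close> the region is \<open>{Infty}\<close>, so a finite
      \<open>z\<close> has to exclude this case; it does, since \<open>cmod a - S\<close> is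
      positive.\<close>
    then have "R \<noteq> 0"
      using Sa by auto
    moreover have "cmod a / R * (1 - S / cmod a) = (cmod a - S) / R"
      using Sa S0 by (auto simp: diff_divide_distrib right_diff_distrib)
    ultimately have "cmod a / R * (1 - S / cmod a) \<le> cmod z"
      using le R0 by (simp add: divide_le_eq)
    then show ?thesis
      using True b \<open>R \<noteq> 0\<close>
      unfolding Gamma_A_def Let_def S_def[symmetric] R_def[symmetric]
        a_def[symmetric] b_def[symmetric] by simp
  next
    case b: False
    define \<beta> where "\<beta> = (cmod b * (S / cmod a) + R) / (cmod b * (1 - S / cmod a))"
    have \<beta>0: "0 \<le> \<beta>"
      using S0 R0 Sa unfolding \<beta>_def by (auto intro!: divide_nonneg_nonneg simp: divide_le_eq_1)
    have bd: "cmod (z - a / b) \<le> \<beta> * cmod z"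
      unfolding \<beta>_def using Gamma_A_bound[OF eq t s Sa b] .
    define c where "c = a / b / complex_of_real (1 - \<beta>\<^sup>2)"
    define \<rho> where "\<rho> = cmod (a / b) * \<beta> / \<bar>1 - \<beta>\<^sup>2\<bar>"
    \<comment> \<open>The square of \<open>bd\<close> makes the left side of the Apollonius identity
      nonpositive. Cancelling the first factor yields the disk or its exterior; for \<beta> equal to
      1, \<open>bd\<close> itself describes the half-plane.\<close>
    have "(1 - \<beta>\<^sup>2) * ((cmod (z - c))\<^sup>2 - \<rho>\<^sup>2) \<le> 0" if "\<beta>\<^sup>2 \<noteq> 1"
      using Apollonius_identity[OF that, of z "a / b"] power_mono[OF bd norm_ge_zero, of 2]
      unfolding c_def \<rho>_def by linarith
    note ap = this
    have \<rho>0: "0 \<le> \<rho>"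
      using \<beta>0 by (simp add: \<rho>_def)
    have lt: "cmod (z - c) \<le> \<rho>" if "\<beta> < 1"
    proof -
      have "\<beta>\<^sup>2 < 1"
        using that \<beta>0 by (simp add: abs_square_less_1)
      with ap have "(cmod (z - c))\<^sup>2 \<le> \<rho>\<^sup>2"
        by (auto simp: mult_le_0_iff)
      then show ?thesis
        using \<rho>0 by (rule power2_le_imp_le)
    qed
    have gt: "\<rho> \<le> cmod (z - c)" if "\<beta> > 1"
    proof -
      have "\<beta>\<^sup>2 > 1"
        using that by (simp add: one_less_power)
      with ap have "\<rho>\<^sup>2 \<le> (cmod (z - c))\<^sup>2"
        by (auto simp: mult_le_0_iff)
      then show ?thesis
        by (rule power2_le_imp_le) simp
    qed
    show ?thesis
      using True b lt gt bd
      unfolding Gamma_A_def Let_def S_def[symmetric] R_def[symmetric]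
        a_def[symmetric] b_def[symmetric] \<beta>_def[symmetric] c_def[symmetric] \<rho>_def[symmetric]
      by (auto simp: not_less)
  qed
qed

text \<open>Among the shapes of the region only the disk, which needs \<beta> below 1, omits
  \<open>Infty\<close>. Failure of dominance gives \<open>cmod b \<le> R\<close>, and this pushes
  \<beta> up to at least 1.\<close>

lemma Infty_in_Gamma_A:
  assumes "\<not> strictly_diag_dominant_row B i"
  shows "Infty \<in> Gamma_A A B i"
proof -
  define S where "S = (\<Sum>j\<in>UNIV - {i}. cmod (A $ i $ j))"
  define R where "R = (\<Sum>j\<in>UNIV - {i}. cmod (B $ i $ j))"
  define a where "a = A $ i $ i"
  define b where "b = B $ i $ i"
  have "1 \<le> (cmod b * (S / cmod a) + R) / (cmod b * (1 - S / cmod a))"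
    if "strictly_diag_dominant_row A i" "b \<noteq> 0"
  proof -
    have Sa: "S < cmod a"
      using that(1) by (simp add: strictly_diag_dominant_row_def S_def a_def)
    have S0: "0 \<le> S"
      by (auto simp: S_def intro: sum_nonneg)
    have r: "S / cmod a < 1" "0 \<le> S / cmod a"
      using Sa S0 by (auto simp: divide_less_eq_1)
    have "cmod b \<le> R"
      using assms by (simp add: strictly_diag_dominant_row_def R_def b_def)
    moreover have "0 \<le> cmod b * (S / cmod a)"
      using r by (intro mult_nonneg_nonneg) auto
    ultimately have "cmod b * (1 - S / cmod a) \<le> cmod b * (S / cmod a) + R"
      unfolding right_diff_distrib by linarith
    moreover have "0 < cmod b * (1 - S / cmod a)"
      using r that(2) by simp
    ultimately show ?thesis
      by (simp add: le_divide_eq)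
  qed
  then show ?thesis
    unfolding Gamma_A_def Let_def S_def[symmetric] R_def[symmetric]
      a_def[symmetric] b_def[symmetric] by auto
qed

theorem corollary2p5:
  fixes A B :: "complex^'n^'n"
  assumes "\<And>i. strictly_diag_dominant_row A i \<or> strictly_diag_dominant_row B i"
  shows "pencil_eigenvalues A B \<subseteq> (\<Union>i. Gamma_S A B i)"
proof
  fix \<mu>
  assume \<mu>: "\<mu> \<in> pencil_eigenvalues A B"
  show "\<mu> \<in> (\<Union>i. Gamma_S A B i)"
  proof (cases \<mu>)
    case (Fin z)
    with \<mu> obtain x where x: "x \<noteq> 0" "A *v x = z *s (B *v x)"
      by (auto simp: Fin_in_pencil_eigenvalues)
    obtain i where i: "x $ i \<noteq> 0" "\<And>j. cmod (x $ j) \<le> cmod (x $ i)"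
      using exists_max_entry[OF x(1)] by blast
    obtain t where t: "(A *v x) $ i = x $ i * (A $ i $ i + t)"
      "cmod t \<le> (\<Sum>j\<in>UNIV - {i}. cmod (A $ i $ j))"
      using row_at_max_entry[OF i, where M = A] by blast
    obtain s where s: "(B *v x) $ i = x $ i * (B $ i $ i + s)"
      "cmod s \<le> (\<Sum>j\<in>UNIV - {i}. cmod (B $ i $ j))"
      using row_at_max_entry[OF i, where M = B] by blast
    have "x $ i * (A $ i $ i + t) = x $ i * (z * (B $ i $ i + s))"
      unfolding t(1)[symmetric] x(2) by (simp add: s(1) mult.left_commute)
    then have "A $ i $ i + t = z * (B $ i $ i + s)"
      using i(1) by simp
    \<comment> \<open>The same scalar relation serves both branches of
      \<open>Gamma_S\<close>.\<close>
    then have "Fin z \<in> Gamma_S A B i"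
      using Fin_in_Gamma_A Fin_in_Gamma_B t(2) s(2) by (auto simp: Gamma_S_def)
    then show ?thesis
      using Fin by blast
  next
    case Infty
    with \<mu> obtain x where x: "x \<noteq> 0" "B *v x = 0"
      by (auto simp: Infty_in_pencil_eigenvalues)
    obtain i where i: "x $ i \<noteq> 0" "\<And>j. cmod (x $ j) \<le> cmod (x $ i)"
      using exists_max_entry[OF x(1)] by blast
    obtain s where s: "(B *v x) $ i = x $ i * (B $ i $ i + s)"
      "cmod s \<le> (\<Sum>j\<in>UNIV - {i}. cmod (B $ i $ j))"
      using row_at_max_entry[OF i, where M = B] by blast
    \<comment> \<open>Row \<open>i\<close> of \<open>B *v x = 0\<close>, divided by
      \<open>x $ i\<close>. It shows that row \<open>i\<close> of \<open>B\<close> is not dominant,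
      so \<open>Gamma_S\<close> takes its \<open>Gamma_A\<close> branch here.\<close>
    have "B $ i $ i = - s"
      using x(2) s(1) i(1) by (simp add: eq_neg_iff_add_eq_0)
    with s(2) have "\<not> strictly_diag_dominant_row B i"
      by (simp add: strictly_diag_dominant_row_def)
    then have "Infty \<in> Gamma_S A B i"
      by (simp add: Gamma_S_def Infty_in_Gamma_A)
    then show ?thesis
      using Infty by blast
  qed
qed

end
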